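(* Let $\mathbf{M} = (h_{\alpha\beta}) \in \mathbb{R}^{l \times w}$ be a real matrix subject to a total of $q$ structural constraints, each belonging to one of the following two classes: (1) specified elements, i.e. $h_{\alpha\beta} = b_0$, where $h_{\alpha\beta}$ is the $(\alpha,\beta)$-th element of $\mathbf{M}$ and $b_0$ is a specific constant (e.g. $0$ or $1$); (2) repetitive elements, i.e. $h_{\alpha_1\beta_1} = h_{\alpha_2\beta_2}$, where $(\alpha_1,\beta_1) \neq (\alpha_2,\beta_2)$. Then, in $\operatorname{vec}(\mathbf{M})$, these structural constraints are linear and can be expressed as $$\mathbf{Q}^{\top} \operatorname{vec}(\mathbf{M}) = \mathbf{b},$$ where $\mathbf{Q} = [\mathbf{q}_1 \ \mathbf{q}_2 \ \dots \ \mathbf{q}_q] \in \mathbb{R}^{lw \times q}$, with columns $\mathbf{q}_j \in \mathbb{R}^{lw}$, is a matrix of $\operatorname{rank}(\mathbf{Q}) = q$ for the total of $q$ constraints, and $\mathbf{b} \in \mathbb{R}^{q}$, $\mathbf{b}^{\top} = [b_1 \ b_2 \ \dots \ b_q]$ with $b_j \in \mathbb{R}$, is a vector of known constants.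
   Context: For $\mathbf{M} = (h_{\alpha\beta}) \in \mathbb{R}^{l\times w}$, $\operatorname{vec}(\mathbf{M}) = [h_{11}, h_{21}, \dots, h_{l1}, h_{12}, h_{22}, \dots, h_{l2}, \dots, h_{1w}, h_{2w}, \dots, h_{lw}]^{\top} \in \mathbb{R}^{lw}$ denotes the vectorization of $\mathbf{M}$, in which the columns of $\mathbf{M}$ are stacked one after another into a column vector of length $lw$.
   Formalization: It is additionally assumed that none of the q structural constraints is implied by the others; without this rank(Q) = q can fail, e.g. when the same constraint is listed twice or three elements are equated pairwise. *)

theory Defs
  imports "Jordan_Normal_Form.DL_Rank"
begin

text \<open>Column-major vectorization. Indices start at 0, so the entry in row \<open>i\<close> and column \<open>j\<close>
  of an \<open>l \<times> w\<close> matrix is put at position \<open>j * l + i\<close>.\<close>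

definition vectorize :: "'a mat \<Rightarrow> 'a vec" where
  "vectorize M = vec (dim_row M * dim_col M) (\<lambda>k. M $$ (k mod dim_row M, k div dim_row M))"

datatype structural_constraint =
    Specified "nat \<times> nat" real
  | Repeated "nat \<times> nat" "nat \<times> nat"

fun wf_constraint :: "nat \<Rightarrow> nat \<Rightarrow> structural_constraint \<Rightarrow> bool" where
  "wf_constraint l w (Specified p b0) \<longleftrightarrow> p \<in> {..<l} \<times> {..<w}"
| "wf_constraint l w (Repeated p p') \<longleftrightarrow>
     p \<in> {..<l} \<times> {..<w} \<and> p' \<in> {..<l} \<times> {..<w} \<and> p \<noteq> p'"

fun satisfies :: "real mat \<Rightarrow> structural_constraint \<Rightarrow> bool" where
  "satisfies M (Specified p b0) \<longleftrightarrow> M $$ p = b0"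
| "satisfies M (Repeated p p') \<longleftrightarrow> M $$ p = M $$ p'"

text \<open>No constraint is a consequence of the other ones. Without this, the coefficient vectors
  can be linearly dependent: the same constraint may be listed twice, or three entries may be
  equated pairwise.\<close>

definition irredundant :: "nat \<Rightarrow> nat \<Rightarrow> nat \<Rightarrow> (nat \<Rightarrow> structural_constraint) \<Rightarrow> bool" where
  "irredundant l w q c \<longleftrightarrow>
     (\<forall>j<q. \<exists>N\<in>carrier_mat l w. (\<forall>i<q. i \<noteq> j \<longrightarrow> satisfies N (c i)) \<and> \<not> satisfies N (c j))"

end

theory Submission
  imports Defs
begin

text \<open>The coefficient vector of a constraint is a unit vector or a difference of two unit vectors.
  If \<open>N\<close> violates the \<open>j\<close>-th constraint and satisfies all the others, then
  \<open>vectorize N - vectorize M\<close> is orthogonal to every coefficient vector except the \<open>j\<close>-th one.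
  So irredundancy provides a family dual (up to scaling) to the columns of \<open>Q\<close>, which are
  therefore linearly independent.\<close>

lemma (in vec_space) full_rank_if_kernel_trivial:
  assumes A: "A \<in> carrier_mat n nc"
    and kernel_trivial: "\<And>v. v \<in> carrier_vec nc \<Longrightarrow> A *\<^sub>v v = 0\<^sub>v n \<Longrightarrow> v = 0\<^sub>v nc"
  shows "rank A = nc"
proof (rule lin_indpt_full_rank[OF A])
  have "col A i \<noteq> col A j" if ij: "i < nc" "j < nc" "i \<noteq> j" for i j
  proof
    let ?v = "unit_vec nc i - unit_vec nc j :: 'a vec"
    assume "col A i = col A j"
    then have "A $$ (k, i) = A $$ (k, j)" if "k < n" for k
      using A ij that by (metis carrier_matD index_col)
    then have "A *\<^sub>v ?v = 0\<^sub>v n"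
      using A ij by (intro eq_vecI) (auto simp: scalar_prod_minus_distrib[of _ nc])
    then have "?v = 0\<^sub>v nc" by (intro kernel_trivial) auto
    then have "?v $ i = 0" using ij by simp
    with ij show False by simp
  qed
  with A show distinct: "distinct (cols A)" by (simp add: distinct_conv_nth)
  show "lin_indpt (set (cols A))"
    using lin_depE[OF A _ distinct] kernel_trivial by metis
qed

lemma kernel_trivial_if_dual_family:
  fixes A :: "'a :: idom mat"
  assumes A: "A \<in> carrier_mat n nc"
    and dual: "\<And>j. j < nc \<Longrightarrow>
      \<exists>d\<in>carrier_vec n. (\<forall>i<nc. i \<noteq> j \<longrightarrow> col A i \<bullet> d = 0) \<and> col A j \<bullet> d \<noteq> 0"
    and v: "v \<in> carrier_vec nc" "A *\<^sub>v v = 0\<^sub>v n"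
  shows "v = 0\<^sub>v nc"
proof (rule eq_vecI)
  fix j assume "j < dim_vec (0\<^sub>v nc :: 'a vec)"
  then have j: "j < nc" by simp
  from dual[OF j] obtain d where d: "d \<in> carrier_vec n" "col A j \<bullet> d \<noteq> 0"
    and orthogonal: "\<And>i. i < nc \<Longrightarrow> i \<noteq> j \<Longrightarrow> col A i \<bullet> d = 0"
    by blast
  have "0 = (A\<^sup>T *\<^sub>v d) \<bullet> v"
    using transpose_vec_mult_scalar[OF A v(1) d(1)] v(2) d(1) by simp
  also have "\<dots> = (\<Sum>i<nc. (col A i \<bullet> d) * v $ i)"
    using A v(1) by (simp add: scalar_prod_def atLeast0LessThan)
  also have "\<dots> = (\<Sum>i\<in>{j}. (col A i \<bullet> d) * v $ i)"
    using j orthogonal by (intro sum.mono_neutral_right) auto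
  finally show "v $ j = 0\<^sub>v nc $ j" using d(2) j by simp
qed (use v in simp)

lemma (in vec_space) full_rank_if_irredundant_equations:
  assumes A: "A \<in> carrier_mat n nc"
    and solution: "x \<in> carrier_vec n" "A\<^sup>T *\<^sub>v x = b"
    and irredundant: "\<And>j. j < nc \<Longrightarrow>
      \<exists>y\<in>carrier_vec n. (\<forall>i<nc. i \<noteq> j \<longrightarrow> col A i \<bullet> y = b $ i) \<and> col A j \<bullet> y \<noteq> b $ j"
  shows "rank A = nc"
proof (intro full_rank_if_kernel_trivial[OF A] kernel_trivial_if_dual_family[OF A])
  fix j assume "j < nc"
  then obtain y where y: "y \<in> carrier_vec n" "col A j \<bullet> y \<noteq> b $ j"
    "\<And>i. i < nc \<Longrightarrow> i \<noteq> j \<Longrightarrow> col A i \<bullet> y = b $ i"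
    using irredundant by blast
  have "col A i \<bullet> (y - x) = col A i \<bullet> y - b $ i" if "i < nc" for i
    using A solution that y(1) by (auto simp: scalar_prod_minus_distrib[of _ n])
  with y solution(1) \<open>j < nc\<close> show
    "\<exists>d\<in>carrier_vec n. (\<forall>i<nc. i \<noteq> j \<longrightarrow> col A i \<bullet> d = 0) \<and> col A j \<bullet> d \<noteq> 0"
    by (intro bexI[of _ "y - x"]) auto
qed

lemma vectorize_carrier:
  "N \<in> carrier_mat l w \<Longrightarrow> vectorize N \<in> carrier_vec (l * w)"
  by (auto simp: vectorize_def)

fun entry_position :: "nat \<Rightarrow> nat \<times> nat \<Rightarrow> nat" where
  "entry_position l (i, j) = j * l + i"

lemma entry_position_less:
  assumes "p \<in> {..<l} \<times> {..<w}"
  shows "entry_position l p < l * w"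
proof -
  obtain i j where p: "p = (i, j)" "i < l" "j < w" using assms by auto
  have "j * l + i < Suc j * l" using p(2) by simp
  also have "\<dots> \<le> w * l" using p(3) by (intro mult_le_mono1) simp
  finally show ?thesis using p(1) by (simp add: mult.commute)
qed

lemma unit_vec_scalar_prod_vectorize:
  fixes N :: "'a :: semiring_1 mat"
  assumes N: "N \<in> carrier_mat l w" and p: "p \<in> {..<l} \<times> {..<w}"
  shows "unit_vec (l * w) (entry_position l p) \<bullet> vectorize N = N $$ p"
proof -
  have "unit_vec (l * w) (entry_position l p) \<bullet> vectorize N = vectorize N $ entry_position l p"
    using vectorize_carrier[OF N] entry_position_less[OF p] by simp
  also have "\<dots> = N $$ p"
    using N p entry_position_less[OF p] by (auto simp: vectorize_def)
  finally show ?thesis .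
qed

fun coeff_vec :: "nat \<Rightarrow> nat \<Rightarrow> structural_constraint \<Rightarrow> real vec" where
  "coeff_vec l w (Specified p b0) = unit_vec (l * w) (entry_position l p)"
| "coeff_vec l w (Repeated p p') =
     unit_vec (l * w) (entry_position l p) - unit_vec (l * w) (entry_position l p')"

fun const_term :: "structural_constraint \<Rightarrow> real" where
  "const_term (Specified p b0) = b0"
| "const_term (Repeated p p') = 0"

lemma coeff_vec_carrier: "coeff_vec l w k \<in> carrier_vec (l * w)"
  by (cases k) auto

lemma satisfies_iff_coeff_vec:
  assumes N: "N \<in> carrier_mat l w" and wf: "wf_constraint l w k"
  shows "satisfies N k \<longleftrightarrow> coeff_vec l w k \<bullet> vectorize N = const_term k"
proof (cases k)
  case (Specified p b0)
  with wf show ?thesis by (simp add: unit_vec_scalar_prod_vectorize[OF N] del: mem_Sigma_iff)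
next
  case (Repeated p p')
  with wf have "coeff_vec l w k \<bullet> vectorize N = N $$ p - N $$ p'"
    by (simp add: minus_scalar_prod_distrib[OF _ _ vectorize_carrier[OF N]]
        unit_vec_scalar_prod_vectorize[OF N] del: mem_Sigma_iff)
  with Repeated show ?thesis by simp
qed

definition coeff_mat :: "nat \<Rightarrow> nat \<Rightarrow> nat \<Rightarrow> (nat \<Rightarrow> structural_constraint) \<Rightarrow> real mat" where
  "coeff_mat l w q c = mat_of_cols (l * w) (map (\<lambda>j. coeff_vec l w (c j)) [0..<q])"

definition const_vec :: "nat \<Rightarrow> (nat \<Rightarrow> structural_constraint) \<Rightarrow> real vec" where
  "const_vec q c = vec q (\<lambda>j. const_term (c j))"

lemma coeff_mat_carrier: "coeff_mat l w q c \<in> carrier_mat (l * w) q"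
  by (simp add: coeff_mat_def mat_of_cols_def)

lemma const_vec_carrier: "const_vec q c \<in> carrier_vec q"
  by (simp add: const_vec_def)

lemma satisfies_iff_col_coeff_mat:
  assumes "N \<in> carrier_mat l w" "wf_constraint l w (c j)" "j < q"
  shows "satisfies N (c j) \<longleftrightarrow> col (coeff_mat l w q c) j \<bullet> vectorize N = const_vec q c $ j"
  using assms satisfies_iff_coeff_vec[of N l w "c j"]
  by (simp add: coeff_mat_def const_vec_def coeff_vec_carrier)

lemma satisfies_all_iff_coeff_mat:
  assumes N: "N \<in> carrier_mat l w" and wf: "\<forall>j<q. wf_constraint l w (c j)"
  shows "(\<forall>j<q. satisfies N (c j)) \<longleftrightarrow> (coeff_mat l w q c)\<^sup>T *\<^sub>v vectorize N = const_vec q c"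
  using satisfies_iff_col_coeff_mat[OF N] wf coeff_mat_carrier[of l w q c] const_vec_carrier[of q c]
  by (auto simp: vec_eq_iff)

lemma rank_coeff_mat:
  assumes M: "M \<in> carrier_mat l w"
    and wf: "\<forall>j<q. wf_constraint l w (c j)"
    and sat: "\<forall>j<q. satisfies M (c j)"
    and irredundant: "irredundant l w q c"
  shows "vec_space.rank (l * w) (coeff_mat l w q c) = q"
proof (rule vec_space.full_rank_if_irredundant_equations)
  show "coeff_mat l w q c \<in> carrier_mat (l * w) q" by (rule coeff_mat_carrier)
  show "vectorize M \<in> carrier_vec (l * w)" using M by (rule vectorize_carrier)
  show "(coeff_mat l w q c)\<^sup>T *\<^sub>v vectorize M = const_vec q c"
    using sat by (simp only: satisfies_all_iff_coeff_mat[OF M wf])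
  fix j assume j: "j < q"
  with irredundant obtain N where N: "N \<in> carrier_mat l w"
    and others: "\<And>i. i < q \<Longrightarrow> i \<noteq> j \<Longrightarrow> satisfies N (c i)" and violated: "\<not> satisfies N (c j)"
    unfolding irredundant_def by blast
  have "\<forall>i<q. i \<noteq> j \<longrightarrow> col (coeff_mat l w q c) i \<bullet> vectorize N = const_vec q c $ i"
    using others wf satisfies_iff_col_coeff_mat[OF N] by blast
  moreover have "col (coeff_mat l w q c) j \<bullet> vectorize N \<noteq> const_vec q c $ j"
    using violated wf j satisfies_iff_col_coeff_mat[OF N] by blast
  ultimately show "\<exists>y\<in>carrier_vec (l * w).
      (\<forall>i<q. i \<noteq> j \<longrightarrow> col (coeff_mat l w q c) i \<bullet> y = const_vec q c $ i) \<and>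
      col (coeff_mat l w q c) j \<bullet> y \<noteq> const_vec q c $ j"
    using vectorize_carrier[OF N] by blast
qed

theorem lemma3:
  fixes M :: "real mat" and l w q :: nat and c :: "nat \<Rightarrow> structural_constraint"
  assumes "M \<in> carrier_mat l w"
    and "\<forall>j<q. wf_constraint l w (c j)"
    and "\<forall>j<q. satisfies M (c j)"
    and "irredundant l w q c"
  shows "\<exists>Q\<in>carrier_mat (l * w) q. \<exists>b\<in>carrier_vec q.
           vec_space.rank (l * w) Q = q \<and>
           transpose_mat Q *\<^sub>v vectorize M = b \<and>
           (\<forall>N\<in>carrier_mat l w.
              (\<forall>j<q. satisfies N (c j) \<longleftrightarrow> col Q j \<bullet> vectorize N = b $ j) \<and>
              ((\<forall>j<q. satisfies N (c j)) \<longleftrightarrow> transpose_mat Q *\<^sub>v vectorize N = b))"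
proof (intro bexI conjI ballI)
  show "coeff_mat l w q c \<in> carrier_mat (l * w) q" by (rule coeff_mat_carrier)
  show "const_vec q c \<in> carrier_vec q" by (rule const_vec_carrier)
  show "vec_space.rank (l * w) (coeff_mat l w q c) = q" using assms by (rule rank_coeff_mat)
  show "(coeff_mat l w q c)\<^sup>T *\<^sub>v vectorize M = const_vec q c"
    using assms(3) by (simp only: satisfies_all_iff_coeff_mat[OF assms(1,2)])
  fix N :: "real mat" assume N: "N \<in> carrier_mat l w"
  show "\<forall>j<q. satisfies N (c j) \<longleftrightarrow>
      col (coeff_mat l w q c) j \<bullet> vectorize N = const_vec q c $ j"
    using satisfies_iff_col_coeff_mat[OF N] assms(2) by blast
  show "(\<forall>j<q. satisfies N (c j)) \<longleftrightarrow>
      (coeff_mat l w q c)\<^sup>T *\<^sub>v vectorize N = const_vec q c"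
    using N assms(2) by (rule satisfies_all_iff_coeff_mat)
qed

end
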